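(* Let $X$ be a strongly $0$-dimensional metrizable space with $\operatorname{card}(X)\le\mathfrak{c}$. Then $\mathrm{SR}(X)$ is dense in $(\mathrm{Met}(X),\mathcal{D}_X)$. Moreover, if $X$ is $\sigma$-compact, then $\mathrm{SR}(X)$ is a dense $G_\delta$ subset of $(\mathrm{Met}(X),\mathcal{D}_X)$.
   Context: For a topological space $X$, $\mathrm{Met}(X)$ denotes the set of all metrics on $X$ generating the topology of $X$, equipped with the supremum metric $\mathcal{D}_X(d,e)=\sup_{x,y\in X}|d(x,y)-e(x,y)|$ (values in $[0,\infty]$) and the topology generated by its open balls. $\mathfrak{c}$ is the cardinality of the continuum. A topological space is strongly $0$-dimensional if for every pair $A,B$ of disjoint closed subsets there is a clopen set $V$ with $A\subseteq V$, $V\cap B=\emptyset$. A metric $d$ on a set $X$ is strongly rigid if for all $x,y,u,v\in X$, $d(x,y)=d(u,v)\neq0$ implies $\{x,y\}=\{u,v\}$. $\mathrm{SR}(X)$ is the set of all strongly rigid metrics in $\mathrm{Met}(X)$. A $G_\delta$ set is a countable intersection of open sets. *)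

theory Defs
  imports "HOL-Analysis.Analysis" "HOL-Library.Equipollence"
begin

text \<open>Met(X): metrics on the carrier of X generating the topology of X.
  To avoid junk representatives, metrics are required to vanish off the carrier.\<close>
definition Met :: "'a topology \<Rightarrow> ('a \<Rightarrow> 'a \<Rightarrow> real) set" where
  "Met X = {d. Metric_space (topspace X) d
              \<and> Metric_space.mtopology (topspace X) d = X
              \<and> (\<forall>x y. x \<notin> topspace X \<or> y \<notin> topspace X \<longrightarrow> d x y = 0)}"

definition supdist :: "'a topology \<Rightarrow> ('a \<Rightarrow> 'a \<Rightarrow> real) \<Rightarrow> ('a \<Rightarrow> 'a \<Rightarrow> real) \<Rightarrow> ennreal" where
  "supdist X d e = (SUP p \<in> topspace X \<times> topspace X. ennreal \<bar>d (fst p) (snd p) - e (fst p) (snd p)\<bar>)"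

definition MetTop :: "'a topology \<Rightarrow> ('a \<Rightarrow> 'a \<Rightarrow> real) topology" where
  "MetTop X = topology_generated_by
     {{e \<in> Met X. supdist X d e < ennreal r} | d r. d \<in> Met X \<and> r > 0}"

definition strongly_rigid_on :: "'a set \<Rightarrow> ('a \<Rightarrow> 'a \<Rightarrow> real) \<Rightarrow> bool" where
  "strongly_rigid_on S d \<longleftrightarrow>
     (\<forall>x\<in>S. \<forall>y\<in>S. \<forall>u\<in>S. \<forall>v\<in>S. d x y = d u v \<and> d x y \<noteq> 0 \<longrightarrow> {x, y} = {u, v})"

definition SR :: "'a topology \<Rightarrow> ('a \<Rightarrow> 'a \<Rightarrow> real) set" where
  "SR X = {d \<in> Met X. strongly_rigid_on (topspace X) d}"

definition strongly_zero_dim :: "'a topology \<Rightarrow> bool" where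
  "strongly_zero_dim X \<longleftrightarrow>
     (\<forall>A B. closedin X A \<and> closedin X B \<and> A \<inter> B = {} \<longrightarrow>
        (\<exists>V. closedin X V \<and> openin X V \<and> A \<subseteq> V \<and> V \<inter> B = {}))"

definition sigma_compact :: "'a topology \<Rightarrow> bool" where
  "sigma_compact X \<longleftrightarrow>
     (\<exists>\<K>. countable \<K> \<and> (\<forall>K\<in>\<K>. compactin X K) \<and> \<Union>\<K> = topspace X)"

end

theory Submission
  imports Defs
begin

text \<open>
  Density. By an argument in the style of Stone's paracompactness theorem, a strongly
  zero-dimensional metric space \<open>(X, d)\<close> has, for every \<open>\<delta> > 0\<close>, a locally constant map
  \<open>f : X \<rightarrow> X\<close> moving points by less than \<open>\<delta>\<close>. Composing such maps with an injection
  \<open>X \<rightarrow> \<real>\<close> and with indicators of rational intervals gives countably many locally constant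
  functions \<open>s\<^sub>m : X \<rightarrow> \<real>\<close> which recover the topology and which detect each pair \<open>{x, y}\<close>: if
  \<open>x \<notin> {y, u, v}\<close> then some \<open>s\<^sub>m\<close> separates \<open>x\<close> from \<open>y\<close> but not \<open>u\<close> from \<open>v\<close>. The metric
  \<open>e x y = \<delta> (\<lceil>d (f x) (f y) / \<delta>\<rceil> + \<Sum>m. 4^-(m+1) [s\<^sub>m x \<noteq> s\<^sub>m y])\<close> is uniformly close to \<open>d\<close>;
  rounding up is subadditive, and each digit is a pseudometric, so the triangle inequality is
  immediate. The integral part and the digits can be read off from \<open>e x y\<close>, so \<open>e\<close> is
  strongly rigid.

  The \<open>G_\<delta>\<close> property. On a compact set of quadruples \<open>(x, y, u, v)\<close> the condition
  \<open>d x y \<noteq> d u v\<close> is open in \<open>d\<close>, and if \<open>X\<close> is \<open>\<sigma>\<close>-compact, the quadruples with \<open>x \<noteq> y\<close> and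
  \<open>{x, y} \<noteq> {u, v}\<close> form a countable union of compact sets.
\<close>

section \<open>Locally constant maps\<close>

definition locally_constant :: "'a topology \<Rightarrow> ('a \<Rightarrow> 'b) \<Rightarrow> bool" where
  "locally_constant X f \<longleftrightarrow>
     (\<forall>x\<in>topspace X. \<exists>U. openin X U \<and> x \<in> U \<and> (\<forall>y\<in>U. f y = f x))"

lemma locally_constant_compose: "locally_constant X f \<Longrightarrow> locally_constant X (\<lambda>x. g (f x))"
  unfolding locally_constant_def by metis

lemma locally_constant_finite:
  assumes "\<And>m. m < N \<Longrightarrow> locally_constant X (s m)" and x: "x \<in> topspace X"
  shows "\<exists>U. openin X U \<and> x \<in> U \<and> (\<forall>y\<in>U. \<forall>m<N::nat. s m y = s m x)"
  using assms(1)
proof (induction N)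
  case 0
  then show ?case using x by auto
next
  case (Suc N)
  have "locally_constant X (s m)" if "m < N" for m using Suc.prems that by simp
  then obtain U where U: "openin X U" "x \<in> U" "\<forall>y\<in>U. \<forall>m<N. s m y = s m x"
    using Suc.IH by blast
  have "locally_constant X (s N)" using Suc.prems by simp
  then obtain V where V: "openin X V" "x \<in> V" "\<forall>y\<in>V. s N y = s N x"
    using x unfolding locally_constant_def by blast
  have "openin X (U \<inter> V)" "x \<in> U \<inter> V" using U V by auto
  moreover have "\<forall>y\<in>U \<inter> V. \<forall>m<Suc N. s m y = s m x"
    using U(3) V(3) less_Suc_eq by blast
  ultimately show ?case by blast
qed

text \<open>Well-order the indices and let \<open>\<alpha> x\<close> be the least index admissible
  for \<open>x\<close>. If \<open>\<alpha> x\<close> and \<open>\<alpha> y\<close> differ, the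
  smaller one cannot be admissible for both points, since the other point would then have chosen it
  too.\<close>

lemma exists_least_choice:
  fixes P :: "'b \<Rightarrow> 'a \<Rightarrow> bool"
  assumes "\<And>x. x \<in> M \<Longrightarrow> \<exists>a. P a x"
  shows "\<exists>\<alpha>. (\<forall>x\<in>M. P (\<alpha> x) x) \<and>
    (\<forall>x\<in>M. \<forall>y\<in>M. \<alpha> x \<noteq> \<alpha> y \<longrightarrow> \<not> P (\<alpha> x) y \<or> \<not> P (\<alpha> y) x)"
proof -
  obtain r :: "'b rel" where r: "well_order_on UNIV r"
    using well_order_on by blast
  have wf: "wf (r - Id)" and tot: "total_on UNIV r"
    using r by (auto simp: well_order_on_def linear_order_on_def)
  have "\<forall>x\<in>M. \<exists>a. P a x \<and> (\<forall>b. (b, a) \<in> r - Id \<longrightarrow> \<not> P b x)"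
  proof
    fix x assume "x \<in> M"
    then obtain a where "a \<in> {a. P a x}" using assms by blast
    then obtain z where "z \<in> {a. P a x}" "\<And>y. (y, z) \<in> r - Id \<Longrightarrow> y \<notin> {a. P a x}"
      using wfE_min[OF wf] by metis
    then show "\<exists>a. P a x \<and> (\<forall>b. (b, a) \<in> r - Id \<longrightarrow> \<not> P b x)"
      by (intro exI[of _ z]) simp
  qed
  then obtain \<alpha> where \<alpha>: "\<And>x. x \<in> M \<Longrightarrow> P (\<alpha> x) x"
    and least: "\<And>x b. \<lbrakk>x \<in> M; (b, \<alpha> x) \<in> r - Id\<rbrakk> \<Longrightarrow> \<not> P b x"
    by metis
  have "\<not> P (\<alpha> x) y \<or> \<not> P (\<alpha> y) x" if "x \<in> M" "y \<in> M" "\<alpha> x \<noteq> \<alpha> y" for x y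
  proof -
    have "(\<alpha> x, \<alpha> y) \<in> r - Id \<or> (\<alpha> y, \<alpha> x) \<in> r - Id"
      using tot that(3) by (simp add: total_on_def)
    then show ?thesis using least that by metis
  qed
  with \<alpha> show ?thesis by (intro exI[of _ \<alpha>]) simp
qed

text \<open>The least admissible centre \<open>\<alpha> x\<close> is constant at scale
  \<open>r n\<close> on the set \<open>E n\<close> of points lying at depth \<open>r n\<close>
  inside the ball about their centre. Strong zero-dimensionality gives a clopen \<open>V n\<close>
  between \<open>E n\<close> and its neighbourhood \<open>G n\<close>. Each point then uses the
  first \<open>V n\<close> containing it, and clopenness makes this first index locally constant.
  The depth condition keeps the value within \<epsilon> of the point.\<close>

lemma (in Metric_space) locally_constant_retraction:
  assumes zd: "strongly_zero_dim mtopology" and "\<epsilon> > 0"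
  shows "\<exists>f. locally_constant mtopology f \<and> (\<forall>x\<in>M. f x \<in> M \<and> d (f x) x < \<epsilon>)"
proof -
  have "\<exists>a. a \<in> M \<and> d a x < \<epsilon>" if "x \<in> M" for x
    using that \<open>\<epsilon> > 0\<close> by (intro exI[of _ x]) simp
  from exists_least_choice[of M "\<lambda>a x. a \<in> M \<and> d a x < \<epsilon>", OF this]
  obtain \<alpha> where \<alpha>: "\<And>x. x \<in> M \<Longrightarrow> \<alpha> x \<in> M \<and> d (\<alpha> x) x < \<epsilon>"
    and sep: "\<And>x y. \<lbrakk>x \<in> M; y \<in> M; \<alpha> x \<noteq> \<alpha> y\<rbrakk> \<Longrightarrow> \<not> d (\<alpha> x) y < \<epsilon> \<or> \<not> d (\<alpha> y) x < \<epsilon>"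
    by blast
  define r where "r n = 1 / real (Suc n)" for n
  define E where "E n = {x \<in> M. mball x (r n) \<subseteq> mball (\<alpha> x) \<epsilon>}" for n
  define G where "G n = (\<Union>x\<in>E n. mball x (r n / 2))" for n
  have r0: "r n > 0" for n by (simp add: r_def)
  have EM: "E n \<subseteq> M" for n by (auto simp: E_def)
  \<comment> \<open>This separation lets \<open>\<alpha>\<close> extend from \<open>E n\<close> to a locally constant map on its
    neighbourhood \<open>G n\<close>.\<close>
  have E_sep: "\<alpha> x = \<alpha> y" if "x \<in> E n" "y \<in> E n" "d x y < r n" for x y n
  proof (rule ccontr)
    assume ne: "\<alpha> x \<noteq> \<alpha> y"
    have "y \<in> mball x (r n)" "x \<in> mball y (r n)"
      using that EM by (auto simp: commute)
    then have "y \<in> mball (\<alpha> x) \<epsilon>" "x \<in> mball (\<alpha> y) \<epsilon>"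
      using that by (auto simp: E_def)
    then show False using sep[of x y] ne by auto
  qed
  have E_cover: "\<exists>n. x \<in> E n" if x: "x \<in> M" for x
  proof -
    have "x \<in> mball (\<alpha> x) \<epsilon>" using \<alpha> x by auto
    then obtain \<delta> where "\<delta> > 0" "mball x \<delta> \<subseteq> mball (\<alpha> x) \<epsilon>"
      using openin_mball[of "\<alpha> x" \<epsilon>] unfolding openin_mtopology by blast
    moreover obtain n where "r n < \<delta>"
      using \<open>\<delta> > 0\<close> nat_approx_posE unfolding r_def by blast
    ultimately show ?thesis
      using x mball_subset_concentric[of "r n" \<delta> x] by (auto simp: E_def)
  qed
  \<comment> \<open>A limit point of \<open>E n\<close> is within \<open>r n / 2\<close> of some
    point of \<open>E n\<close>, so the closure of \<open>E n\<close> lies in \<open>G n\<close> and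
    is disjoint from the closed complement of \<open>G n\<close>.\<close>
  have "\<exists>V. closedin mtopology V \<and> openin mtopology V \<and> E n \<subseteq> V \<and> V \<subseteq> G n" for n
  proof -
    have "mtopology closure_of E n \<subseteq> G n"
    proof
      fix y assume "y \<in> mtopology closure_of E n"
      then obtain x where "y \<in> M" "x \<in> E n" "x \<in> mball y (r n / 2)"
        using r0[of n] half_gt_zero[OF r0[of n]] unfolding metric_closure_of by blast
      then show "y \<in> G n" by (auto simp: G_def commute)
    qed
    moreover have "openin mtopology (G n)" by (auto simp: G_def)
    ultimately have "closedin mtopology (M - G n)" "mtopology closure_of E n \<inter> (M - G n) = {}"
      using openin_closedin_eq by auto
    then obtain V where "closedin mtopology V" "openin mtopology V"
      "mtopology closure_of E n \<subseteq> V" "V \<inter> (M - G n) = {}"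
      using zd[unfolded strongly_zero_dim_def, rule_format, of "mtopology closure_of E n" "M - G n"]
        closedin_closure_of[of mtopology "E n"] by auto
    moreover from this have "V \<subseteq> M" using closedin_subset[of mtopology V] by simp
    moreover have "E n \<subseteq> mtopology closure_of E n"
      using EM closure_of_subset[of "E n" mtopology] by simp
    ultimately show ?thesis by (intro exI[of _ V]) auto
  qed
  then obtain V where V: "\<And>n. closedin mtopology (V n)" "\<And>n. openin mtopology (V n)"
    "\<And>n. E n \<subseteq> V n" "\<And>n. V n \<subseteq> G n"
    by metis
  \<comment> \<open>The choice does not affect the value: two points of \<open>E n\<close> within
    \<open>r n / 2\<close> of \<open>z\<close> are less than \<open>r n\<close> apart, so they have
    the same centre by \<open>E_sep\<close>.\<close>
  define \<beta> where "\<beta> n z = \<alpha> (SOME x. x \<in> E n \<and> d x z < r n / 2)" for n z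
  have \<beta>: "\<beta> n z = \<alpha> x" if "x \<in> E n" "d x z < r n / 2" "z \<in> M" for n z x
  proof -
    define x' where "x' = (SOME x. x \<in> E n \<and> d x z < r n / 2)"
    have x': "x' \<in> E n \<and> d x' z < r n / 2"
      unfolding x'_def by (rule someI_ex) (use that in blast)
    then have "d x' x < r n"
      using triangle'[of x' z x] that EM by force
    then show ?thesis
      unfolding \<beta>_def x'_def[symmetric] using E_sep x' that by blast
  qed
  define N where "N z = (LEAST n. z \<in> V n)" for z
  have N: "z \<in> V (N z)" if "z \<in> M" for z
    unfolding N_def using E_cover[OF that] V(3) by (metis LeastI subsetD)
  define f where "f z = \<beta> (N z) z" for z
  have main: "\<exists>x\<in>E (N z). d x z < r (N z) / 2 \<and> x \<in> M" if "z \<in> M" for z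
  proof -
    have "z \<in> G (N z)" using N[OF that] V(4)[of "N z"] by blast
    then show ?thesis by (auto simp: G_def)
  qed
  have f1: "f z \<in> M \<and> d (f z) z < \<epsilon>" if z: "z \<in> M" for z
  proof -
    obtain x where x: "x \<in> E (N z)" "d x z < r (N z) / 2" "x \<in> M" using main[OF z] by blast
    then have "z \<in> mball x (r (N z))" using z r0[of "N z"] by auto
    then have "z \<in> mball (\<alpha> x) \<epsilon>" using x by (auto simp: E_def)
    then show ?thesis using \<beta>[OF x(1,2) z] by (auto simp: f_def)
  qed
  have "\<exists>U. openin mtopology U \<and> z \<in> U \<and> (\<forall>y\<in>U. f y = f z)" if z: "z \<in> M" for z
  proof -
    obtain x where x: "x \<in> E (N z)" "d x z < r (N z) / 2" "x \<in> M" using main[OF z] by blast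
    \<comment> \<open>Removing the finitely many earlier closed \<open>V m\<close> fixes the first
      index on \<open>U\<close>; the ball lets the same \<open>x\<close> witness the value of
      \<beta> at every point of \<open>U\<close>.\<close>
    define U where "U = mball x (r (N z) / 2) \<inter> (V (N z) - (\<Union>m\<in>{..<N z}. V m))"
    have "openin mtopology U"
      unfolding U_def using V by (intro openin_Int openin_diff openin_mball closedin_Union) auto
    moreover have "z \<in> U"
    proof -
      have "z \<notin> V m" if "m < N z" for m
        using that not_less_Least unfolding N_def by blast
      then show ?thesis using x z N[OF z] unfolding U_def by simp
    qed
    moreover have "f y = f z" if y: "y \<in> U" for y
    proof -
      have y1: "y \<in> V (N z)" and y2: "y \<in> M" "d x y < r (N z) / 2"
        using y by (simp_all add: U_def)
      have y3: "y \<notin> V m" if "m < N z" for m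
        using y that by (simp add: U_def)
      have "N y = N z"
        unfolding N_def[of y]
      proof (rule Least_equality)
        show "N z \<le> m" if "y \<in> V m" for m
          using that y3[of m] by (meson not_le)
      qed (rule y1)
      then have "f y = \<alpha> x" "f z = \<alpha> x"
        unfolding f_def using \<beta>[OF x(1) y2(2) y2(1)] \<beta>[OF x(1,2) z] by simp_all
      then show ?thesis by simp
    qed
    ultimately show ?thesis by blast
  qed
  then show ?thesis
    using f1 unfolding locally_constant_def topspace_mtopology by (intro exI[of _ f] conjI) blast+
qed

section \<open>Base four digit sums\<close>

text \<open>Base four with digits 0 and 1 leaves gaps: the digits after a position contribute at
  most a third of that position's unit, so no two sequences share a sum (in base two they could).
  The total is at most 1/3, so the sum cannot carry into an integral part.\<close>

definition digit_sum :: "(nat \<Rightarrow> bool) \<Rightarrow> real" where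
  "digit_sum b = (\<Sum>m. if b m then (1/4) ^ Suc m else 0)"

lemma quarter_sums: "(\<lambda>m. (1/4::real) ^ Suc m) sums (1/3)"
  using sums_mult[OF geometric_sums[of "1/4::real"], of "1/4"] by simp

lemma summable_digits: "summable (\<lambda>m. if b m then (1/4::real) ^ Suc m else 0)"
  by (rule summable_comparison_test'[OF sums_summable[OF quarter_sums], of 0]) auto

lemma digit_sum_nonneg: "0 \<le> digit_sum b"
  unfolding digit_sum_def by (rule suminf_nonneg[OF summable_digits]) auto

lemma digit_sum_le: "digit_sum b \<le> 1/3"
  unfolding digit_sum_def sums_unique[OF quarter_sums]
  by (rule suminf_le[OF _ summable_digits sums_summable[OF quarter_sums]]) auto

lemma digit_sum_subadditive:
  assumes "\<And>m. b m \<Longrightarrow> b1 m \<or> b2 m"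
  shows "digit_sum b \<le> digit_sum b1 + digit_sum b2"
  unfolding digit_sum_def suminf_add[OF summable_digits summable_digits]
  by (rule suminf_le[OF _ summable_digits summable_add[OF summable_digits summable_digits]])
    (use assms in auto)

lemma digit_sum_shift: "digit_sum b = (of_bool (b 0) + digit_sum (\<lambda>m. b (Suc m))) / 4"
proof -
  have "digit_sum b = (if b 0 then 1/4 else 0) + (\<Sum>m. 1/4 * (if b (Suc m) then (1/4) ^ Suc m else 0))"
    unfolding digit_sum_def using suminf_split_head[OF summable_digits, of b]
    by (simp add: if_distrib cong: if_cong)
  also have "\<dots> = (of_bool (b 0) + digit_sum (\<lambda>m. b (Suc m))) / 4"
    unfolding digit_sum_def by (subst suminf_mult[OF summable_digits]) auto
  finally show ?thesis .
qed

text \<open>Four times the sum is the first digit plus a remainder in [0, 1/3], which determines the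
  first digit. Subtracting it leaves the sum of the shifted sequence, where the argument
  repeats.\<close>

lemma digit_sum_inject: "digit_sum b = digit_sum b' \<Longrightarrow> b m = b' m"
proof (induction m arbitrary: b b')
  case 0
  then show ?case
    using digit_sum_shift[of b] digit_sum_shift[of b'] digit_sum_nonneg[of "\<lambda>m. b (Suc m)"]
      digit_sum_nonneg[of "\<lambda>m. b' (Suc m)"] digit_sum_le[of "\<lambda>m. b (Suc m)"]
      digit_sum_le[of "\<lambda>m. b' (Suc m)"]
    by (auto simp: of_bool_def split: if_splits)
next
  case (Suc m)
  have "b 0 = b' 0"
    using Suc.prems digit_sum_shift[of b] digit_sum_shift[of b'] digit_sum_nonneg[of "\<lambda>m. b (Suc m)"]
      digit_sum_nonneg[of "\<lambda>m. b' (Suc m)"] digit_sum_le[of "\<lambda>m. b (Suc m)"]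
      digit_sum_le[of "\<lambda>m. b' (Suc m)"]
    by (auto simp: of_bool_def split: if_splits)
  then have "digit_sum (\<lambda>m. b (Suc m)) = digit_sum (\<lambda>m. b' (Suc m))"
    using Suc.prems digit_sum_shift[of b] digit_sum_shift[of b'] by simp
  then show ?case using Suc.IH by blast
qed

text \<open>Together with \<open>digit_sum_tail\<close> this compares topologies: a small sum forces
  a given digit to vanish, and the vanishing of many initial digits forces a small sum.\<close>

lemma digit_sum_ge: "b m \<Longrightarrow> (1/4) ^ Suc m \<le> digit_sum b"
proof (induction m arbitrary: b)
  case 0
  then show ?case using digit_sum_shift[of b] digit_sum_nonneg[of "\<lambda>m. b (Suc m)"] by simp
next
  case (Suc m)
  have "(1/4) ^ Suc m \<le> digit_sum (\<lambda>m. b (Suc m))"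
    by (rule Suc.IH) (use Suc.prems in simp)
  then show ?case
    using digit_sum_shift[of b] by (auto simp: of_bool_def split: if_splits)
qed

lemma digit_sum_tail: "(\<And>m. m < N \<Longrightarrow> \<not> b m) \<Longrightarrow> digit_sum b \<le> (1/4) ^ N"
proof (induction N arbitrary: b)
  case 0
  then show ?case using digit_sum_le[of b] by simp
next
  case (Suc N)
  have "digit_sum (\<lambda>m. b (Suc m)) \<le> (1/4) ^ N"
    by (rule Suc.IH) (use Suc.prems in simp)
  then show ?case using digit_sum_shift[of b] Suc.prems[of 0] by simp
qed

lemma digit_sum_False [simp]: "digit_sum (\<lambda>m. False) = 0"
  by (simp add: digit_sum_def)

section \<open>Strongly rigid approximation\<close>

lemma openin_mtopology_transfer:
  assumes "Metric_space M d" "Metric_space M e"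
    and "\<And>x \<epsilon>. \<lbrakk>x \<in> M; \<epsilon> > 0\<rbrakk> \<Longrightarrow> \<exists>\<delta>>0. \<forall>y\<in>M. d x y < \<delta> \<longrightarrow> e x y < \<epsilon>"
    and "openin (Metric_space.mtopology M e) U"
  shows "openin (Metric_space.mtopology M d) U"
proof -
  interpret d: Metric_space M d by fact
  interpret e: Metric_space M e by fact
  have U: "U \<subseteq> M" "\<And>x. x \<in> U \<Longrightarrow> \<exists>r>0. e.mball x r \<subseteq> U"
    using assms(4) unfolding e.openin_mtopology by auto
  show ?thesis
    unfolding d.openin_mtopology
  proof (intro conjI allI impI)
    fix x assume x: "x \<in> U"
    then obtain r where "r > 0" and r: "e.mball x r \<subseteq> U" using U by blast
    then obtain \<delta> where "\<delta> > 0" "\<forall>y\<in>M. d x y < \<delta> \<longrightarrow> e x y < r"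
      using assms(3)[of x r] x U by blast
    then show "\<exists>r>0. d.mball x r \<subseteq> U" using r by (intro exI[of _ \<delta>]) auto
  qed (use U in blast)
qed

lemma mtopology_eqI:
  assumes "Metric_space M d" "Metric_space M e"
    and "\<And>x \<epsilon>. \<lbrakk>x \<in> M; \<epsilon> > 0\<rbrakk> \<Longrightarrow> \<exists>\<delta>>0. \<forall>y\<in>M. d x y < \<delta> \<longrightarrow> e x y < \<epsilon>"
    and "\<And>x \<epsilon>. \<lbrakk>x \<in> M; \<epsilon> > 0\<rbrakk> \<Longrightarrow> \<exists>\<delta>>0. \<forall>y\<in>M. e x y < \<delta> \<longrightarrow> d x y < \<epsilon>"
  shows "Metric_space.mtopology M d = Metric_space.mtopology M e"
  unfolding topology_eq
  using openin_mtopology_transfer[OF assms(1,2,3)] openin_mtopology_transfer[OF assms(2,1,4)] by blast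

text \<open>For nonnegative \<open>r\<close> this is the closed \<open>supdist\<close> ball of
  radius \<open>r\<close>, stated without suprema or extended reals. By
  \<open>openin_MetTop_iff\<close> these balls describe the topology of
  \<open>MetTop X\<close>.\<close>

definition unif_close :: "'a topology \<Rightarrow> real \<Rightarrow> ('a \<Rightarrow> 'a \<Rightarrow> real) \<Rightarrow> ('a \<Rightarrow> 'a \<Rightarrow> real) \<Rightarrow> bool" where
  "unif_close X r d e \<longleftrightarrow> (\<forall>x\<in>topspace X. \<forall>y\<in>topspace X. \<bar>d x y - e x y\<bar> \<le> r)"

lemma ceiling_triangle:
  fixes a b c \<delta> :: real
  assumes "\<delta> > 0" "c \<le> a + b"
  shows "\<lceil>c / \<delta>\<rceil> \<le> \<lceil>a / \<delta>\<rceil> + \<lceil>b / \<delta>\<rceil>"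
proof -
  have "c / \<delta> \<le> a / \<delta> + b / \<delta>"
    using assms by (simp add: add_divide_distrib[symmetric] divide_right_mono)
  then have "\<lceil>c / \<delta>\<rceil> \<le> \<lceil>a / \<delta> + b / \<delta>\<rceil>" by (rule ceiling_mono)
  also have "\<dots> \<le> \<lceil>a / \<delta>\<rceil> + \<lceil>b / \<delta>\<rceil>" by (rule ceiling_add_le)
  finally show ?thesis .
qed

text \<open>Even indices carry the maps \<open>h n\<close>, whose fibres have small diameter; odd
  indices carry indicators of rational intervals pulled back along the \<open>h n\<close>. The
  indicators are needed because \<open>h n\<close> may itself separate \<open>u\<close> from
  \<open>v\<close>, whereas an indicator can be 1 at \<open>x\<close> and 0 at \<open>y\<close>,
  \<open>u\<close> and \<open>v\<close>.\<close>

lemma (in Metric_space) exists_separating_sequence: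
  fixes g :: "'a \<Rightarrow> real"
  assumes zd: "strongly_zero_dim mtopology" and g: "inj_on g M"
  shows "\<exists>s :: nat \<Rightarrow> 'a \<Rightarrow> real. (\<forall>m. locally_constant mtopology (s m)) \<and>
    (\<forall>\<epsilon>>0. \<exists>m. \<forall>x\<in>M. \<forall>y\<in>M. s m x = s m y \<longrightarrow> d x y < \<epsilon>) \<and>
    (\<forall>x\<in>M. \<forall>y\<in>M. \<forall>u\<in>M. \<forall>v\<in>M. x \<notin> {y, u, v} \<longrightarrow> (\<exists>m. s m x \<noteq> s m y \<and> s m u = s m v))"
proof -
  \<comment> \<open>The factor 2 is there because points with equal images are compared through
    their common image, which costs two such distances.\<close>
  have "\<exists>F. locally_constant mtopology F \<and> (\<forall>x\<in>M. F x \<in> M \<and> d (F x) x < 1 / (2 * real (Suc n)))" for n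
    by (rule locally_constant_retraction[OF zd]) simp
  then obtain F where F_lc: "\<And>n. locally_constant mtopology (F n)"
    and F: "\<And>n x. x \<in> M \<Longrightarrow> F n x \<in> M \<and> d (F n x) x < 1 / (2 * real (Suc n))"
    by metis
  define h where "h n x = g (F n x)" for n x
  have h_lc: "locally_constant mtopology (h n)" for n
    unfolding h_def by (rule locally_constant_compose[OF F_lc])
  have h: "d x y < 1 / real (Suc n)" if "x \<in> M" "y \<in> M" "h n x = h n y" for x y n
  proof -
    have eq: "F n x = F n y" using that F g unfolding h_def inj_on_def by blast
    have "d x y \<le> d (F n x) x + d (F n x) y"
      using triangle''[of x "F n x" y] that F by blast
    also have "\<dots> < 1 / (2 * real (Suc n)) + 1 / (2 * real (Suc n))"
      using F[OF that(1), of n] F[OF that(2), of n] unfolding eq by linarith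
    finally show ?thesis by (simp add: field_simps)
  qed
  define t :: "nat \<Rightarrow> 'a \<Rightarrow> real" where "t k x = (case from_nat k of (n, q, r) \<Rightarrow>
      of_bool (of_rat q < h n x \<and> h n x < of_rat r))" for k x
  define s where "s m = (if even m then h (m div 2) else t (m div 2))" for m :: nat
  have t_lc: "locally_constant mtopology (t k)" for k
  proof -
    obtain n q r where "from_nat k = (n :: nat, q :: rat, r :: rat)" by (metis prod_cases3)
    then have "t k = (\<lambda>x. (\<lambda>a. of_bool (of_rat q < a \<and> a < of_rat r)) (h n x))"
      by (simp add: t_def fun_eq_iff)
    then show ?thesis
      using locally_constant_compose[OF h_lc[of n], of "\<lambda>a. of_bool (of_rat q < a \<and> a < of_rat r)"] by simp
  qed
  have "locally_constant mtopology (s m)" for m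
    using t_lc h_lc by (cases "even m") (simp_all add: s_def)
  moreover have "\<exists>m. \<forall>x\<in>M. \<forall>y\<in>M. s m x = s m y \<longrightarrow> d x y < \<epsilon>" if eps: "\<epsilon> > 0" for \<epsilon>
  proof -
    obtain n where n: "1 / real (Suc n) < \<epsilon>" using nat_approx_posE[OF eps] by blast
    have "s (2 * n) = h n" by (simp add: s_def)
    then show ?thesis using h n by (metis order.strict_trans)
  qed
  moreover have "\<exists>m. s m x \<noteq> s m y \<and> s m u = s m v"
    if in_M: "x \<in> M" "y \<in> M" "u \<in> M" "v \<in> M" and ne: "x \<notin> {y, u, v}" for x y u v
  proof -
    \<comment> \<open>Once 1/(n+1) is below all three distances, \<open>h n x\<close> differs from
      \<open>h n\<close> at \<open>y\<close>, \<open>u\<close> and \<open>v\<close>.\<close>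
    have "min (d x y) (min (d x u) (d x v)) > 0" using that by simp
    then obtain n where n: "1 / real (Suc n) < min (d x y) (min (d x u) (d x v))"
      using nat_approx_posE by blast
    have ne: "h n y \<noteq> h n x" "h n u \<noteq> h n x" "h n v \<noteq> h n x"
      using h[of x y n] h[of x u n] h[of x v n] n in_M by auto
    \<comment> \<open>The open interval of radius \<epsilon> about \<open>h n x\<close> misses the
      other three values, and so does any rational interval inside it.\<close>
    define \<epsilon> where "\<epsilon> = min \<bar>h n y - h n x\<bar> (min \<bar>h n u - h n x\<bar> \<bar>h n v - h n x\<bar>)"
    have "\<epsilon> > 0" using ne by (simp add: \<epsilon>_def)
    obtain q where q: "h n x - \<epsilon> < of_rat q" "of_rat q < h n x"
      using of_rat_dense[of "h n x - \<epsilon>" "h n x"] \<open>\<epsilon> > 0\<close> by auto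
    obtain r where r: "h n x < of_rat r" "of_rat r < h n x + \<epsilon>"
      using of_rat_dense[of "h n x" "h n x + \<epsilon>"] \<open>\<epsilon> > 0\<close> by auto
    define k where "k = to_nat (n, q, r)"
    have t: "t k z = of_bool (of_rat q < h n z \<and> h n z < of_rat r)" for z
      by (simp add: t_def k_def)
    have "t k z = 0" if "\<epsilon> \<le> \<bar>h n z - h n x\<bar>" for z
      using that q r unfolding t by (auto simp: abs_if split: if_splits)
    then have "t k y = 0" "t k u = 0" "t k v = 0" by (simp_all add: \<epsilon>_def)
    moreover have "t k x = 1" using q r by (simp add: t)
    moreover have "s (2 * k + 1) = t k" by (simp add: s_def)
    ultimately show ?thesis by (intro exI[of _ "2 * k + 1"]) simp
  qed
  ultimately show ?thesis by (intro exI[of _ s]) blast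
qed

text \<open>If both alternatives failed, the distinct points \<open>x\<close> and \<open>y\<close>
  would both lie in \<open>{u, v}\<close> and exhaust it. Either alternative is a configuration that
  the separating sequence handles.\<close>

lemma doubleton_neqE:
  assumes "{x, y} \<noteq> {u, v}" "x \<noteq> y" "u \<noteq> v"
  shows "x \<notin> {y, u, v} \<or> y \<notin> {x, u, v}"
  using assms by auto

lemma strongly_rigid_approximation:
  fixes X :: "'a topology" and g :: "'a \<Rightarrow> real"
  assumes zd: "strongly_zero_dim X" and g: "inj_on g (topspace X)"
    and d: "d \<in> Met X" and "\<delta> > 0"
  shows "\<exists>e\<in>SR X. unif_close X (4 * \<delta>) d e"
proof -
  define M where "M = topspace X"
  interpret Metric_space M d using d by (simp add: Met_def M_def)
  have X: "mtopology = X" using d by (simp add: Met_def M_def)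
  obtain f where f_lc: "locally_constant X f" and f: "\<And>x. x \<in> M \<Longrightarrow> f x \<in> M \<and> d (f x) x < \<delta>"
    using locally_constant_retraction[of \<delta>] zd \<open>\<delta> > 0\<close> unfolding X by blast
  obtain s :: "nat \<Rightarrow> 'a \<Rightarrow> real" where s_lc: "\<And>m. locally_constant X (s m)"
    and s_small: "\<And>\<epsilon>. \<epsilon> > 0 \<Longrightarrow> \<exists>m. \<forall>x\<in>M. \<forall>y\<in>M. s m x = s m y \<longrightarrow> d x y < \<epsilon>"
    and s_sep: "\<And>x y u v. \<lbrakk>x \<in> M; y \<in> M; u \<in> M; v \<in> M; x \<notin> {y, u, v}\<rbrakk> \<Longrightarrow>
       \<exists>m. s m x \<noteq> s m y \<and> s m u = s m v"
    using exists_separating_sequence[of g] zd g unfolding X M_def[symmetric] by metis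
  \<comment> \<open>The ceiling turns every positive distance into at least 1. Measuring between the
    images under the locally constant \<open>f\<close> makes \<open>C\<close> vanish for points
    close to a given one, so \<open>e\<close> still induces the topology of
    \<open>X\<close>.\<close>
  define C where "C x y = \<lceil>d (f x) (f y) / \<delta>\<rceil>" for x y
  define S where "S x y = digit_sum (\<lambda>m. s m x \<noteq> s m y)" for x y
  \<comment> \<open>The value 0 off the carrier is the normalisation that \<open>Met\<close>
    demands.\<close>
  define e where "e x y = (if x \<in> M \<and> y \<in> M then \<delta> * (of_int (C x y) + S x y) else 0)" for x y
  have e: "e x y = \<delta> * (of_int (C x y) + S x y)" if "x \<in> M" "y \<in> M" for x y
    using that by (simp add: e_def)
  have C0: "C x y \<ge> 0" for x y
    unfolding C_def using \<open>\<delta> > 0\<close> by (simp add: order.strict_trans2[of "-1" 0])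
  have S0: "S x y \<ge> 0" and S1: "S x y \<le> 1/3" for x y
    unfolding S_def by (rule digit_sum_nonneg digit_sum_le)+
  have S_le_e: "\<delta> * S x y \<le> e x y" if "x \<in> M" "y \<in> M" for x y
    unfolding e[OF that] using C0[of x y] \<open>\<delta> > 0\<close> by (intro mult_left_mono) auto
  \<comment> \<open>A single nonzero digit at position \<open>m\<close> already contributes
    \<open>\<delta> * (1/4) ^ Suc m\<close> to \<open>e x y\<close>, so below this bound
    \<open>s m\<close> agrees at the two points.\<close>
  have e_small: "d x y < \<epsilon>"
    if "x \<in> M" "y \<in> M" "e x y < \<delta> * (1/4) ^ Suc m"
      "\<forall>x\<in>M. \<forall>y\<in>M. s m x = s m y \<longrightarrow> d x y < \<epsilon>" for x y m \<epsilon>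
  proof -
    have "\<delta> * S x y < \<delta> * (1/4) ^ Suc m"
      using S_le_e[OF that(1,2)] that(3) by linarith
    then have "S x y < (1/4) ^ Suc m" using \<open>\<delta> > 0\<close> by (simp only: mult_less_cancel_left_pos)
    then have "s m x = s m y"
      using digit_sum_ge[of "\<lambda>m. s m x \<noteq> s m y" m] unfolding S_def by linarith
    then show ?thesis using that by blast
  qed
  have e_metric: "Metric_space M e"
  proof
    show "0 \<le> e x y" for x y
      using C0[of x y] S0[of x y] \<open>\<delta> > 0\<close> by (simp add: e_def)
    show "e x y = e y x" for x y
    proof -
      have "C x y = C y x" unfolding C_def by (simp only: commute[of "f x" "f y"])
      moreover have "S x y = S y x" unfolding S_def by (rule arg_cong[where f = digit_sum]) auto
      ultimately show ?thesis by (simp add: e_def)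
    qed
    show "e x y = 0 \<longleftrightarrow> x = y" if "x \<in> M" "y \<in> M" for x y
    proof
      assume e0: "e x y = 0"
      have "d x y < \<epsilon>" if eps: "\<epsilon> > 0" for \<epsilon>
      proof -
        obtain m where "\<forall>x\<in>M. \<forall>y\<in>M. s m x = s m y \<longrightarrow> d x y < \<epsilon>"
          using s_small[OF eps] by blast
        then show ?thesis using e_small[of x y m \<epsilon>] e0 \<open>x \<in> M\<close> \<open>y \<in> M\<close> \<open>\<delta> > 0\<close> by simp
      qed
      from this[of "d x y"] show "x = y" using that mdist_pos_less by blast
    next
      assume "x = y"
      then show "e x y = 0" using that f[of x] by (simp add: e_def C_def S_def)
    qed
    show "e x z \<le> e x y + e y z" if "x \<in> M" "y \<in> M" "z \<in> M" for x y z
    proof -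
      have "C x z \<le> C x y + C y z"
        unfolding C_def using f that by (intro ceiling_triangle[OF \<open>\<delta> > 0\<close>] triangle) auto
      moreover have "S x z \<le> S x y + S y z"
        unfolding S_def by (rule digit_sum_subadditive) auto
      ultimately have "of_int (C x z) + S x z \<le> (of_int (C x y) + S x y) + (of_int (C y z) + S y z)"
        by linarith
      then show ?thesis
        using that \<open>\<delta> > 0\<close> by (simp only: e mult_left_mono distrib_left[symmetric])
    qed
  qed
  have "mtopology = Metric_space.mtopology M e"
  proof (rule mtopology_eqI[OF Metric_space_axioms e_metric])
    fix x \<epsilon> assume x: "x \<in> M" and "(\<epsilon>::real) > 0"
    \<comment> \<open>Near \<open>x\<close>, the set \<open>V\<close> kills the integral part and
      \<open>U\<close> kills the first \<open>N\<close> digits, leaving at most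
      \<open>\<delta> * (1/4) ^ N\<close>.\<close>
    obtain N where N: "(1/4::real) ^ N < \<epsilon> / \<delta>"
      using real_arch_pow_inv[of "\<epsilon> / \<delta>" "1/4"] \<open>\<epsilon> > 0\<close> \<open>\<delta> > 0\<close> by auto
    obtain U where U: "openin X U" "x \<in> U" "\<forall>y\<in>U. \<forall>m<N. s m y = s m x"
      using locally_constant_finite[of N X s x] s_lc x by (auto simp: M_def)
    obtain V where V: "openin X V" "x \<in> V" "\<forall>y\<in>V. f y = f x"
      using f_lc x unfolding locally_constant_def M_def by blast
    have "openin mtopology (U \<inter> V)" using U V by (simp add: X openin_Int)
    then obtain r where "r > 0" and r: "mball x r \<subseteq> U \<inter> V"
      using U V unfolding openin_mtopology by blast
    have "e x y < \<epsilon>" if y: "y \<in> M" "d x y < r" for y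
    proof -
      have y': "y \<in> U" "y \<in> V" using r y x by auto
      have "C x y = 0" unfolding C_def using V(3) y' f[OF x] by simp
      moreover have "S x y \<le> (1/4) ^ N"
        unfolding S_def by (rule digit_sum_tail) (use U(3) y' in metis)
      ultimately have "of_int (C x y) + S x y < \<epsilon> / \<delta>" using N by linarith
      then show ?thesis using x y \<open>\<delta> > 0\<close> by (simp add: e field_simps)
    qed
    then show "\<exists>r>0. \<forall>y\<in>M. d x y < r \<longrightarrow> e x y < \<epsilon>" using \<open>r > 0\<close> by blast
  next
    fix x \<epsilon> assume x: "x \<in> M" and "(\<epsilon>::real) > 0"
    then obtain m where m: "\<forall>x\<in>M. \<forall>y\<in>M. s m x = s m y \<longrightarrow> d x y < \<epsilon>"
      using s_small by blast
    have "\<forall>y\<in>M. e x y < \<delta> * (1/4) ^ Suc m \<longrightarrow> d x y < \<epsilon>"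
      using e_small[OF x _ _ m] by blast
    moreover have "\<delta> * (1/4) ^ Suc m > 0" using \<open>\<delta> > 0\<close> by simp
    ultimately show "\<exists>r>0. \<forall>y\<in>M. e x y < r \<longrightarrow> d x y < \<epsilon>" by blast
  qed
  then have "e \<in> Met X"
    using e_metric unfolding Met_def X by (auto simp: M_def e_def)
  moreover have "strongly_rigid_on M e"
    unfolding strongly_rigid_on_def
  proof (intro ballI impI, elim conjE)
    fix x y u v assume in_M: "x \<in> M" "y \<in> M" "u \<in> M" "v \<in> M"
      and eq: "e x y = e u v" and "e x y \<noteq> 0"
    then have ne: "x \<noteq> y" "u \<noteq> v" using Metric_space.zero[OF e_metric] by metis+
    have "of_int (C x y) + S x y = of_int (C u v) + S u v"
      using eq in_M \<open>\<delta> > 0\<close> by (simp add: e)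
    \<comment> \<open>Both digit sums lie in [0, 1/3], so the two integers differ by less than
      1.\<close>
    moreover from this have "C x y = C u v"
      using S0[of x y] S0[of u v] S1[of x y] S1[of u v] by linarith
    ultimately have "S x y = S u v" by simp
    then have same: "s m x \<noteq> s m y \<longleftrightarrow> s m u \<noteq> s m v" for m
      unfolding S_def by (rule digit_sum_inject)
    show "{x, y} = {u, v}"
    proof (rule ccontr)
      assume "{x, y} \<noteq> {u, v}"
      then consider "x \<notin> {y, u, v}" | "y \<notin> {x, u, v}" using doubleton_neqE ne by metis
      then show False
      proof cases
        case 1
        then show False using s_sep[of x y u v] in_M same by blast
      next
        case 2
        then show False using s_sep[of y x u v] in_M same by metis
      qed
    qed
  qed
  \<comment> \<open>The error budget: \<open>2 * \<delta>\<close> for moving both points by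
    \<open>f\<close>, \<delta> for rounding up, and \<delta> as a generous bound for the
    digits.\<close>
  moreover have "\<bar>d x y - e x y\<bar> \<le> 4 * \<delta>" if xy: "x \<in> M" "y \<in> M" for x y
  proof -
    have "\<bar>d x y - d (f x) (f y)\<bar> \<le> 2 * \<delta>"
    proof -
      have "d x y \<le> d (f x) x + d (f x) (f y) + d (f y) y"
        using triangle''[of x "f x" y] triangle'[of "f x" "f y" y] triangle[of "f x" "f y" y] f xy
        by force
      moreover have "d (f x) (f y) \<le> d (f x) x + d x y + d (f y) y"
        using triangle[of "f x" x "f y"] triangle'[of x y "f y"] f xy by force
      ultimately show ?thesis using f[OF xy(1)] f[OF xy(2)] by linarith
    qed
    moreover have "d (f x) (f y) \<le> \<delta> * C x y" "\<delta> * C x y \<le> d (f x) (f y) + \<delta>"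
    proof -
      have "d (f x) (f y) / \<delta> \<le> C x y" "C x y \<le> d (f x) (f y) / \<delta> + 1"
        unfolding C_def by linarith+
      then show "d (f x) (f y) \<le> \<delta> * C x y" "\<delta> * C x y \<le> d (f x) (f y) + \<delta>"
        using \<open>\<delta> > 0\<close> by (simp_all add: field_simps)
    qed
    moreover have "0 \<le> \<delta> * S x y" "\<delta> * S x y \<le> \<delta> * 1"
      using S0[of x y] S1[of x y] \<open>\<delta> > 0\<close> by (simp, intro mult_left_mono) auto
    ultimately show ?thesis unfolding e[OF xy] distrib_left by linarith
  qed
  ultimately show ?thesis unfolding SR_def M_def unif_close_def by blast
qed

section \<open>The uniform topology on metrics\<close>

lemma unif_close_mono: "unif_close X r d e \<Longrightarrow> r \<le> s \<Longrightarrow> unif_close X s d e"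
  unfolding unif_close_def by force

lemma unif_closeD: "\<lbrakk>unif_close X r d e; x \<in> topspace X; y \<in> topspace X\<rbrakk> \<Longrightarrow> \<bar>d x y - e x y\<bar> \<le> r"
  unfolding unif_close_def by blast

lemma supdist_leI:
  assumes "\<And>x y. \<lbrakk>x \<in> topspace X; y \<in> topspace X\<rbrakk> \<Longrightarrow> \<bar>d x y - e x y\<bar> \<le> c"
  shows "supdist X d e \<le> ennreal c"
  unfolding supdist_def by (rule SUP_least) (use assms in \<open>auto intro!: ennreal_leI\<close>)

lemma ennreal_le_supdist:
  assumes "x \<in> topspace X" "y \<in> topspace X"
  shows "ennreal \<bar>d x y - e x y\<bar> \<le> supdist X d e"
  unfolding supdist_def using assms by (intro SUP_upper2[of "(x, y)"]) auto

text \<open>With \<open>s\<close> the distance from \<open>c\<close> to \<open>d\<close>, half of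
  the slack \<open>r - s\<close> is a safe radius about \<open>d\<close>: the triangle inequality
  then stays strictly below \<open>r\<close>, although \<open>unif_close\<close> is not
  strict.\<close>

lemma supdist_ball_interior:
  assumes "supdist X c d < ennreal r"
  shows "\<exists>r'>0. \<forall>e. unif_close X r' d e \<longrightarrow> supdist X c e < ennreal r"
proof -
  obtain s where s: "supdist X c d = ennreal s" "0 \<le> s"
    using assms by (cases "supdist X c d") auto
  have "s < r" using assms s by (simp add: ennreal_less_iff)
  have "supdist X c e < ennreal r"
    if e: "unif_close X ((r - s) / 2) d e" for e
  proof -
    have "supdist X c e \<le> ennreal (s + (r - s) / 2)"
    proof (rule supdist_leI)
      fix x y assume xy: "x \<in> topspace X" "y \<in> topspace X"
      have "\<bar>c x y - d x y\<bar> \<le> s"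
        using ennreal_le_supdist[OF xy, of c d] s by simp
      moreover have "\<bar>d x y - e x y\<bar> \<le> (r - s) / 2" using e xy by (rule unif_closeD)
      ultimately show "\<bar>c x y - e x y\<bar> \<le> s + (r - s) / 2" by linarith
    qed
    also have "\<dots> < ennreal r"
      using \<open>s < r\<close> \<open>0 \<le> s\<close> by (intro ennreal_lessI) (simp_all add: field_simps)
    finally show ?thesis .
  qed
  then show ?thesis using \<open>s < r\<close> by (intro exI[of _ "(r - s) / 2"]) auto
qed

lemma supdist_self_less: "r > 0 \<Longrightarrow> supdist X d d < ennreal r"
  using supdist_leI[of X d d 0] by simp

lemma topspace_MetTop: "topspace (MetTop X) = Met X"
proof
  show "topspace (MetTop X) \<subseteq> Met X" unfolding MetTop_def by auto
  show "Met X \<subseteq> topspace (MetTop X)"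
  proof
    fix d assume "d \<in> Met X"
    then have "d \<in> {e \<in> Met X. supdist X d e < ennreal 1}"
      using supdist_self_less[of 1] by simp
    with \<open>d \<in> Met X\<close> show "d \<in> topspace (MetTop X)"
      unfolding MetTop_def topology_generated_by_topspace using zero_less_one[where ?'a = real] by blast
  qed
qed

text \<open>The balls enter the definition only as a subbasis. The forward direction is an induction
  over generated sets, where the basis case recentres a ball by
  \<open>supdist_ball_interior\<close>; conversely, the \<open>supdist\<close> ball of radius
  \<open>r\<close> about \<open>d\<close> lies inside the \<open>unif_close\<close> one.\<close>

lemma openin_MetTop_iff:
  "openin (MetTop X) U \<longleftrightarrow> U \<subseteq> Met X \<and>
     (\<forall>d\<in>U. \<exists>r>0. \<forall>e\<in>Met X. unif_close X r d e \<longrightarrow> e \<in> U)"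
  (is "?L \<longleftrightarrow> _ \<and> ?R U")
proof
  assume U: ?L
  define \<B> where "\<B> = {{e \<in> Met X. supdist X d e < ennreal r} | d r. d \<in> Met X \<and> r > 0}"
  have "generate_topology_on \<B> U"
    using U unfolding MetTop_def \<B>_def openin_topology_generated_by_iff .
  then have "?R U"
  proof induction
    case (Int a b)
    show ?case
    proof
      fix d assume "d \<in> a \<inter> b"
      then obtain r r' where "r > 0" "r' > 0"
        and r: "\<And>e. \<lbrakk>e \<in> Met X; unif_close X r d e\<rbrakk> \<Longrightarrow> e \<in> a"
        and r': "\<And>e. \<lbrakk>e \<in> Met X; unif_close X r' d e\<rbrakk> \<Longrightarrow> e \<in> b"
        using Int.IH by blast
      have "e \<in> a \<inter> b" if "e \<in> Met X" "unif_close X (min r r') d e" for e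
        using r[of e] r'[of e] that unif_close_mono[of X "min r r'" d e] by simp
      then show "\<exists>r>0. \<forall>e\<in>Met X. unif_close X r d e \<longrightarrow> e \<in> a \<inter> b"
        using \<open>r > 0\<close> \<open>r' > 0\<close> by (intro exI[of _ "min r r'"]) simp
    qed
  next
    case (UN K)
    show ?case
    proof
      fix d assume "d \<in> \<Union>K"
      then obtain k where "k \<in> K" "d \<in> k" by blast
      from UN.IH[OF this(1), rule_format, OF this(2)] \<open>k \<in> K\<close>
      show "\<exists>r>0. \<forall>e\<in>Met X. unif_close X r d e \<longrightarrow> e \<in> \<Union>K"
        by blast
    qed
  next
    case (Basis B)
    then obtain c r where B: "B = {e \<in> Met X. supdist X c e < ennreal r}"
      unfolding \<B>_def by blast
    show ?case
    proof
      fix d assume "d \<in> B"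
      then have "supdist X c d < ennreal r" by (simp add: B)
      from supdist_ball_interior[OF this]
      show "\<exists>r>0. \<forall>e\<in>Met X. unif_close X r d e \<longrightarrow> e \<in> B"
        unfolding B by blast
    qed
  qed simp
  then show "U \<subseteq> Met X \<and> ?R U"
    using openin_subset[OF U] by (simp add: topspace_MetTop)
next
  assume R: "U \<subseteq> Met X \<and> ?R U"
  have "\<exists>T. openin (MetTop X) T \<and> d \<in> T \<and> T \<subseteq> U" if dU: "d \<in> U" for d
  proof -
    obtain r where "r > 0"
      and r: "\<And>e. \<lbrakk>e \<in> Met X; unif_close X r d e\<rbrakk> \<Longrightarrow> e \<in> U"
      using R dU by blast
    have "d \<in> Met X" using R dU by blast
    define T where "T = {e \<in> Met X. supdist X d e < ennreal r}"
    have "openin (MetTop X) T"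
      unfolding MetTop_def
      by (rule topology_generated_by_Basis) (use \<open>r > 0\<close> \<open>d \<in> Met X\<close> T_def in blast)
    moreover have "d \<in> T" using \<open>d \<in> Met X\<close> \<open>r > 0\<close> supdist_self_less by (simp add: T_def)
    moreover have "T \<subseteq> U"
    proof
      fix e assume e: "e \<in> T"
      have "\<bar>d x y - e x y\<bar> \<le> r" if xy: "x \<in> topspace X" "y \<in> topspace X" for x y
      proof -
        have "ennreal \<bar>d x y - e x y\<bar> < ennreal r"
          using ennreal_le_supdist[OF xy, of d e] e unfolding T_def by (simp add: order.strict_trans1)
        then show ?thesis by (simp add: ennreal_less_iff)
      qed
      then show "e \<in> U" using r e by (simp add: T_def unif_close_def)
    qed
    ultimately show ?thesis by blast
  qed
  then show ?L by (subst openin_subopen) blast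
qed

lemma dense_in_MetTop:
  assumes "A \<subseteq> Met X"
    and "\<And>d r. \<lbrakk>d \<in> Met X; r > 0\<rbrakk> \<Longrightarrow>
           \<exists>e\<in>A. unif_close X r d e"
  shows "(MetTop X) closure_of A = topspace (MetTop X)"
proof -
  have "\<exists>e. e \<in> A \<and> e \<in> U" if "d \<in> U" "openin (MetTop X) U" for d U
  proof -
    obtain r where "r > 0" "d \<in> Met X"
      and r: "\<And>e. \<lbrakk>e \<in> Met X; unif_close X r d e\<rbrakk> \<Longrightarrow> e \<in> U"
      using \<open>openin (MetTop X) U\<close> \<open>d \<in> U\<close> unfolding openin_MetTop_iff by blast
    obtain e where "e \<in> A" "unif_close X r d e"
      using assms(2)[OF \<open>d \<in> Met X\<close> \<open>r > 0\<close>] by blast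
    then show ?thesis using r assms(1) by blast
  qed
  then show ?thesis unfolding closure_of_def by blast
qed

section \<open>Strongly rigid metrics as a G_delta set\<close>

lemma continuous_map_Met:
  assumes "Metric_space M d" "Metric_space.mtopology M d = X"
    and "continuous_map Z X f" "continuous_map Z X g"
  shows "continuous_map Z euclideanreal (\<lambda>z. d (f z) (g z))"
proof -
  interpret Metric_space M d by fact
  show ?thesis
    using continuous_map_mdist[of Z "metric (M, d)" f g] assms by simp
qed

lemma continuous_map_quad_projections:
  fixes X :: "'a topology"
  defines "Z \<equiv> prod_topology (prod_topology X X) (prod_topology X X)"
  shows "continuous_map Z X (\<lambda>p. fst (fst p))" "continuous_map Z X (\<lambda>p. snd (fst p))"
    "continuous_map Z X (\<lambda>p. fst (snd p))" "continuous_map Z X (\<lambda>p. snd (snd p))"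
  unfolding Z_def
  using continuous_map_compose[OF continuous_map_fst continuous_map_fst]
    continuous_map_compose[OF continuous_map_fst continuous_map_snd]
    continuous_map_compose[OF continuous_map_snd continuous_map_fst]
    continuous_map_compose[OF continuous_map_snd continuous_map_snd]
  unfolding o_def by blast+

text \<open>The continuous function \<open>F\<close> is positive on the compact set
  \<open>A\<close>, hence bounded below there by some \<open>m > 0\<close>. Moving each of the two
  distances by at most \<open>m / 3\<close> changes their difference by at most
  \<open>2 * m / 3\<close>, so it stays nonzero.\<close>

lemma openin_MetTop_avoiding:
  fixes X :: "'a topology"
  assumes A: "compactin (prod_topology (prod_topology X X) (prod_topology X X)) A"
  shows "openin (MetTop X) {d \<in> Met X. \<forall>((x, y), (u, v))\<in>A. d x y \<noteq> d u v}"
  unfolding openin_MetTop_iff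
proof (intro conjI ballI)
  let ?Z = "prod_topology (prod_topology X X) (prod_topology X X)"
  fix d assume "d \<in> {d \<in> Met X. \<forall>((x, y), (u, v))\<in>A. d x y \<noteq> d u v}"
  then have d: "Metric_space (topspace X) d" "Metric_space.mtopology (topspace X) d = X"
    and neq: "\<And>x y u v. ((x, y), (u, v)) \<in> A \<Longrightarrow> d x y \<noteq> d u v"
    by (auto simp: Met_def)
  define F where "F p = \<bar>d (fst (fst p)) (snd (fst p)) - d (fst (snd p)) (snd (snd p))\<bar>" for p
  have cont: "continuous_map ?Z euclideanreal F"
    unfolding F_def
    by (intro continuous_map_real_abs continuous_map_diff continuous_map_Met[OF d]
        continuous_map_quad_projections)
  have "compact (F ` A)" using image_compactin[OF A cont] by simp
  moreover have "F p > 0" if "p \<in> A" for p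
    using neq[of "fst (fst p)" "snd (fst p)" "fst (snd p)" "snd (snd p)"] that by (simp add: F_def)
  ultimately have "\<exists>m>0. \<forall>p\<in>A. m \<le> F p"
  proof (cases "A = {}")
    case False
    then obtain p where "p \<in> A" "\<forall>q\<in>A. F p \<le> F q"
      using compact_attains_inf[of "F ` A"] \<open>compact (F ` A)\<close> by auto
    then show ?thesis using \<open>\<And>p. p \<in> A \<Longrightarrow> F p > 0\<close> by blast
  qed (auto intro: exI[of _ 1])
  then obtain m where "m > 0" and m: "\<And>p. p \<in> A \<Longrightarrow> m \<le> F p" by blast
  have "d' x y \<noteq> d' u v"
    if d': "unif_close X (m / 3) d d'"
      and A': "((x, y), (u, v)) \<in> A" for d' x y u v
  proof -
    have "m \<le> \<bar>d x y - d u v\<bar>" using m[OF A'] by (simp add: F_def)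
    moreover have "x \<in> topspace X" "y \<in> topspace X" "u \<in> topspace X" "v \<in> topspace X"
      using compactin_subset_topspace[OF A] A' by auto
    then have "\<bar>d x y - d' x y\<bar> \<le> m / 3" "\<bar>d u v - d' u v\<bar> \<le> m / 3"
      using unif_closeD[OF d'] by auto
    ultimately show ?thesis using \<open>m > 0\<close> by linarith
  qed
  then show "\<exists>r>0. \<forall>e\<in>Met X. unif_close X r d e \<longrightarrow>
      e \<in> {d \<in> Met X. \<forall>((x, y), (u, v))\<in>A. d x y \<noteq> d u v}"
    using \<open>m > 0\<close> by (intro exI[of _ "m / 3"]) auto
qed auto

text \<open>The two maxima are the max-metric distances from \<open>(x, y)\<close> to
  \<open>(u, v)\<close> and to \<open>(v, u)\<close>. For a metric \<rho> the gap is positive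
  exactly on the quadruples that rigidity has to separate, and its continuity cuts these into the
  closed pieces where it is at least 1/(n+1).\<close>

definition quad_gap :: "('a \<Rightarrow> 'a \<Rightarrow> real) \<Rightarrow> ('a \<times> 'a) \<times> ('a \<times> 'a) \<Rightarrow> real" where
  "quad_gap \<rho> = (\<lambda>((x, y), (u, v)).
     min (\<rho> x y) (min (max (\<rho> x u) (\<rho> y v)) (max (\<rho> x v) (\<rho> y u))))"

lemma (in Metric_space) quad_gap_pos_iff:
  assumes "x \<in> M" "y \<in> M" "u \<in> M" "v \<in> M"
  shows "quad_gap d ((x, y), (u, v)) > 0 \<longleftrightarrow> x \<noteq> y \<and> {x, y} \<noteq> {u, v}"
  using assms by (auto simp: quad_gap_def less_max_iff_disj doubleton_eq_iff)

lemma closedin_quad_gap: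
  assumes "Metric_space M \<rho>" "Metric_space.mtopology M \<rho> = X"
  shows "closedin (prod_topology (prod_topology X X) (prod_topology X X))
    {p \<in> topspace (prod_topology (prod_topology X X) (prod_topology X X)). c \<le> quad_gap \<rho> p}"
proof -
  let ?Z = "prod_topology (prod_topology X X) (prod_topology X X)"
  have "continuous_map ?Z euclideanreal (quad_gap \<rho>)"
    unfolding quad_gap_def case_prod_beta
    by (intro continuous_map_real_min continuous_map_real_max continuous_map_Met[OF assms]
        continuous_map_quad_projections)
  from closedin_continuous_map_preimage[OF this, of "{c..}"] show ?thesis by simp
qed

text \<open>Every quadruple with positive gap has gap at least 1/(n+1) for some \<open>n\<close> and
  lies in a product of four members of \<K>, so the index set exhausts all forbidden coincidences.
  The factor \<open>Met X\<close> also covers an empty \<K>, where the indexed intersection would be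
  everything.\<close>

lemma SR_eq_Inter:
  assumes \<rho>: "Metric_space (topspace X) \<rho>" and \<K>: "\<Union>\<K> = topspace X"
  shows "SR X = Met X \<inter> (\<Inter>(n, K, L, K', L') \<in> UNIV \<times> \<K> \<times> \<K> \<times> \<K> \<times> \<K>.
    {d \<in> Met X. \<forall>((x, y), (u, v))\<in>{p \<in> (K \<times> L) \<times> (K' \<times> L'). 1 / real (Suc n) \<le> quad_gap \<rho> p}.
        d x y \<noteq> d u v})" (is "_ = ?R")
proof (intro equalityI subsetI)
  interpret \<rho>: Metric_space "topspace X" \<rho> by fact
  fix d assume "d \<in> SR X"
  then have "d \<in> Met X" and sr: "strongly_rigid_on (topspace X) d" by (auto simp: SR_def)
  interpret d: Metric_space "topspace X" d using \<open>d \<in> Met X\<close> by (simp add: Met_def)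
  have "d x y \<noteq> d u v" if "1 / real (Suc n) \<le> quad_gap \<rho> ((x, y), (u, v))"
    and M: "x \<in> topspace X" "y \<in> topspace X" "u \<in> topspace X" "v \<in> topspace X" for x y u v n
  proof
    assume eq: "d x y = d u v"
    have "quad_gap \<rho> ((x, y), (u, v)) > 0"
      using that(1) by (rule less_le_trans[rotated]) simp
    then have "x \<noteq> y" "{x, y} \<noteq> {u, v}" using \<rho>.quad_gap_pos_iff[OF M] by auto
    then show False using sr eq M unfolding strongly_rigid_on_def by (metis d.zero)
  qed
  moreover have "K \<subseteq> topspace X" if "K \<in> \<K>" for K using \<K> that by blast
  ultimately show "d \<in> ?R" using \<open>d \<in> Met X\<close> by (clarsimp simp: subset_iff)
next
  interpret \<rho>: Metric_space "topspace X" \<rho> by fact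
  fix d assume d: "d \<in> ?R"
  then have "d \<in> Met X" by blast
  interpret d: Metric_space "topspace X" d using \<open>d \<in> Met X\<close> by (simp add: Met_def)
  have "{x, y} = {u, v}" if M: "x \<in> topspace X" "y \<in> topspace X" "u \<in> topspace X" "v \<in> topspace X"
    and eq: "d x y = d u v" "d x y \<noteq> 0" for x y u v
  proof (rule ccontr)
    assume "{x, y} \<noteq> {u, v}"
    moreover have "x \<noteq> y" using eq M by force
    ultimately have "quad_gap \<rho> ((x, y), (u, v)) > 0" using \<rho>.quad_gap_pos_iff[OF M] by simp
    then obtain n where n: "1 / real (Suc n) < quad_gap \<rho> ((x, y), (u, v))"
      using nat_approx_posE by blast
    obtain K L K' L' where KL: "K \<in> \<K>" "L \<in> \<K>" "K' \<in> \<K>" "L' \<in> \<K>"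
      and xy: "x \<in> K" "y \<in> L" "u \<in> K'" "v \<in> L'"
      using M unfolding \<K>[symmetric] by blast
    have "(n, K, L, K', L') \<in> UNIV \<times> \<K> \<times> \<K> \<times> \<K> \<times> \<K>" using KL by simp
    with d have "\<forall>((x, y), (u, v))\<in>{p \<in> (K \<times> L) \<times> (K' \<times> L'). 1 / real (Suc n) \<le> quad_gap \<rho> p}.
        d x y \<noteq> d u v" by fast
    then have "d x y \<noteq> d u v" using xy n by fastforce
    with eq show False by simp
  qed
  then show "d \<in> SR X" using \<open>d \<in> Met X\<close> unfolding SR_def strongly_rigid_on_def by blast
qed

lemma gdelta_in_SR:
  fixes X :: "'a topology"
  assumes "metrizable_space X" "sigma_compact X"
  shows "gdelta_in (MetTop X) (SR X)"
proof -
  obtain M \<rho> where "Metric_space M \<rho>" and X: "Metric_space.mtopology M \<rho> = X"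
    using assms(1) unfolding metrizable_space_def by blast
  moreover from this have "M = topspace X" using Metric_space.topspace_mtopology by blast
  ultimately have \<rho>: "Metric_space (topspace X) \<rho>" "Metric_space.mtopology (topspace X) \<rho> = X"
    by auto
  obtain \<K> where \<K>: "countable \<K>" "\<And>K. K \<in> \<K> \<Longrightarrow> compactin X K" "\<Union>\<K> = topspace X"
    using assms(2) by (auto simp: sigma_compact_def)
  define U where "U = (\<lambda>(n, K, L, K', L').
    {d \<in> Met X. \<forall>((x, y), (u, v))\<in>{p \<in> (K \<times> L) \<times> (K' \<times> L'). 1 / real (Suc n) \<le> quad_gap \<rho> p}.
        d x y \<noteq> d u v})"
  define I where "I = (UNIV :: nat set) \<times> \<K> \<times> \<K> \<times> \<K> \<times> \<K>"
  have "openin (MetTop X) (U i)" if i: "i \<in> I" for i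
  proof -
    obtain n K L K' L' where i_eq: "i = (n, K, L, K', L')"
      and KL: "K \<in> \<K>" "L \<in> \<K>" "K' \<in> \<K>" "L' \<in> \<K>"
      using i unfolding I_def by (cases i rule: prod_cases5) auto
    let ?Z = "prod_topology (prod_topology X X) (prod_topology X X)"
    have cpt: "compactin ?Z ((K \<times> L) \<times> (K' \<times> L'))"
      using KL \<K>(2) by (simp add: compactin_Times)
    \<comment> \<open>A closed piece meets a compact box in a compact set, which is what
      \<open>openin_MetTop_avoiding\<close> requires.\<close>
    have "compactin ?Z ({p \<in> topspace ?Z. 1 / real (Suc n) \<le> quad_gap \<rho> p} \<inter> (K \<times> L) \<times> (K' \<times> L'))"
      by (rule closed_Int_compactin[OF closedin_quad_gap[OF \<rho>] cpt])
    moreover have "{p \<in> topspace ?Z. 1 / real (Suc n) \<le> quad_gap \<rho> p} \<inter> (K \<times> L) \<times> (K' \<times> L')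
        = {p \<in> (K \<times> L) \<times> (K' \<times> L'). 1 / real (Suc n) \<le> quad_gap \<rho> p}"
      using compactin_subset_topspace[OF cpt] by blast
    ultimately show ?thesis
      unfolding i_eq U_def prod.case by (intro openin_MetTop_avoiding) simp
  qed
  moreover have "countable I" unfolding I_def using \<K>(1) by (intro countable_SIGMA) auto
  \<comment> \<open>Inserting the whole space keeps the countable family nonempty even when \<K> is
    empty.\<close>
  moreover have "SR X = \<Inter>(insert (topspace (MetTop X)) (U ` I))"
    unfolding SR_eq_Inter[OF \<rho>(1) \<K>(3)] topspace_MetTop U_def I_def by simp
  ultimately show ?thesis
    by (simp only:, intro gdelta_in_Inter open_imp_gdelta_in) auto
qed

theorem theorem1p2:
  fixes X :: "'a topology"
  assumes "strongly_zero_dim X"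
    and "metrizable_space X"
    and "topspace X \<lesssim> (UNIV :: real set)"
  shows "(MetTop X) closure_of (SR X) = topspace (MetTop X)
         \<and> (sigma_compact X \<longrightarrow>
              gdelta_in (MetTop X) (SR X) \<and> (MetTop X) closure_of (SR X) = topspace (MetTop X))"
proof -
  obtain g :: "'a \<Rightarrow> real" where g: "inj_on g (topspace X)"
    using assms(3) unfolding lepoll_def by blast
  have "\<exists>e\<in>SR X. unif_close X r d e"
    if "d \<in> Met X" "r > 0" for d r
    \<comment> \<open>The approximation has error \<open>4 * \<delta>\<close>, hence the quarter of
      \<open>r\<close>.\<close>
    using strongly_rigid_approximation[OF assms(1) g that(1), of "r / 4"] that(2) by simp
  then have "(MetTop X) closure_of (SR X) = topspace (MetTop X)"
    by (intro dense_in_MetTop) (auto simp: SR_def)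
  then show ?thesis using gdelta_in_SR[OF assms(2)] by blast
qed

end
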